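(* Let $\mu_1>0$ and $-\mu_1<\mu_2<0$ with $\mu_2/\mu_1\le -1/5^{5/3}$, and consider the homogeneous isotropic incompressible Mooney-Rivlin unit cube with coefficients $\mu_1,\mu_2$ under equitriaxial dead load $\tau$. Then every non-trivial homogeneous triaxial stretch (i.e. with $(\lambda_1,\lambda_2,\lambda_3)\neq(1,1,1)$) which is an equilibrium under the dead load $\tau$ and satisfies the Baker-Ericksen inequalities is unstable.
   Context: Setting. The body occupies $V=(0,1)^3$ in the reference configuration. The Mooney-Rivlin strain-energy function is $$\mathcal W(\lambda_1,\lambda_2,\lambda_3)=\frac{\mu_1}{2}(\lambda_1^2+\lambda_2^2+\lambda_3^2-3)+\frac{\mu_2}{2}(\lambda_1^{-2}+\lambda_2^{-2}+\lambda_3^{-2}-3),$$ where $\lambda_i>0$ are the principal stretches (singular values) of the deformation gradient $\mathbf F$; write $W(\mathbf F)=\mathcal W(\lambda_1,\lambda_2,\lambda_3)$. The material is incompressible: $\det\mathbf F=1$. The total free energy of a deformation $\mathbf x:V\to\mathbb R^3$ with $\nabla\mathbf x=\mathbf F$ under equitriaxial dead load $\tau$ is $E(\mathbf x)=\int_V [W(\mathbf F)-\tau\,\mathrm{tr}(\mathbf F)]\,dV$. Homogeneous triaxial equilibria. A homogeneous triaxial stretch has $\nabla\mathbf x=\mathrm{diag}(\lambda_1,\lambda_2,\lambda_3)$ with constants $\lambda_i>0$, $\lambda_1\lambda_2\lambda_3=1$. It is an equilibrium under dead load $\tau$ if there is a constant $p\in\mathbb R$ with $-\frac{p}{\lambda_i}+\mu_1\lambda_i-\frac{\mu_2}{\lambda_i^3}=\tau$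 for $i=1,2,3$. Baker-Ericksen inequalities (standing assumption on the admissible deformations): $(T_i-T_j)(\lambda_i-\lambda_j)>0$ whenever $\lambda_i\ne\lambda_j$, where $T_i=-p+\mu_1\lambda_i^2-\mu_2\lambda_i^{-2}$ are the principal Cauchy stresses. Equivalently $\mu_1+\mu_2\lambda_k^2>0$ whenever $\{i,j,k\}=\{1,2,3\}$ and $\lambda_i\ne\lambda_j$. Stability. A deformation $\mathbf x$ with $\det\nabla\mathbf x=1$ is unstable if it is not a (non-strict) local minimum of the total free energy, i.e. if it is not true that $E(\mathbf x)\le E(\mathbf y)$ for all continuous, piecewise differentiable deformations $\mathbf y$ of $V$ with $\det\nabla\mathbf y=1$ and with $\sup_V|\nabla\mathbf y-\nabla\mathbf x|$ sufficiently small. *)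

theory Defs
  imports "HOL-Analysis.Analysis"
begin

definition diag_matrix :: "real^3 \<Rightarrow> real^3^3" where
  "diag_matrix l = (\<chi> i j. if i = j then l $ i else 0)"

text \<open>Singular values, listed with multiplicity in an arbitrary order, through the singular value
  decomposition. Positivity restricts the notion to invertible matrices.\<close>

definition principal_stretches :: "real^3^3 \<Rightarrow> real^3 \<Rightarrow> bool" where
  "principal_stretches F l \<longleftrightarrow>
     (\<forall>i. 0 < l $ i) \<and>
     (\<exists>P Q. orthogonal_matrix P \<and> orthogonal_matrix Q \<and> F = P ** diag_matrix l ** transpose Q)"

definition MR_stretch_energy :: "real \<Rightarrow> real \<Rightarrow> real^3 \<Rightarrow> real" where
  "MR_stretch_energy \<mu>1 \<mu>2 l =
     \<mu>1 / 2 * ((\<Sum>i\<in>UNIV. (l $ i)\<^sup>2) - 3) + \<mu>2 / 2 * ((\<Sum>i\<in>UNIV. 1 / (l $ i)\<^sup>2) - 3)"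

definition MR_energy :: "real \<Rightarrow> real \<Rightarrow> real^3^3 \<Rightarrow> real" where
  "MR_energy \<mu>1 \<mu>2 F = MR_stretch_energy \<mu>1 \<mu>2 (SOME l. principal_stretches F l)"

text \<open>The choice of the principal stretches is irrelevant.\<close>

lemma trace_gram_svd:
  assumes "orthogonal_matrix P" "orthogonal_matrix Q"
  shows "trace (transpose (P ** diag_matrix l ** transpose Q) ** (P ** diag_matrix l ** transpose Q))
         = (\<Sum>i\<in>UNIV. (l $ i)\<^sup>2)"
proof -
  let ?D = "diag_matrix l"
  have D: "transpose ?D = ?D"
    by (auto simp: diag_matrix_def transpose_def vec_eq_iff)
  have "transpose (P ** ?D ** transpose Q) ** (P ** ?D ** transpose Q)
        = Q ** (?D ** (transpose P ** P) ** ?D ** transpose Q)"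
    by (simp add: matrix_transpose_mul D matrix_mul_assoc)
  also have "\<dots> = Q ** (?D ** ?D ** transpose Q)"
    using assms(1) by (simp add: orthogonal_matrix)
  also have "trace \<dots> = trace ((?D ** ?D ** transpose Q) ** Q)"
    by (rule trace_mul_sym)
  also have "\<dots> = trace (?D ** ?D ** (transpose Q ** Q))"
    by (simp add: matrix_mul_assoc)
  also have "\<dots> = trace (?D ** ?D)"
    using assms(2) by (simp add: orthogonal_matrix)
  also have "\<dots> = (\<Sum>i\<in>UNIV. (l $ i)\<^sup>2)"
    by (simp add: trace_def matrix_matrix_mult_def diag_matrix_def if_distrib sum.delta
        power2_eq_square cong: if_cong)
  finally show ?thesis .
qed

lemma svd_inverse:
  assumes "orthogonal_matrix P" "orthogonal_matrix Q" "\<forall>i. 0 < l $ i"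
  shows "(P ** diag_matrix l ** transpose Q) ** (Q ** diag_matrix (\<chi> i. 1 / l $ i) ** transpose P) = mat 1"
proof -
  let ?D = "diag_matrix l" and ?E = "diag_matrix (\<chi> i. 1 / l $ i)"
  have nz: "l $ i \<noteq> 0" for i using assms(3) by (metis less_irrefl)
  have DE: "?D ** ?E = mat 1"
    using nz by (simp add: vec_eq_iff matrix_matrix_mult_def diag_matrix_def mat_def forall_3 sum_3)
  have "(P ** ?D ** transpose Q) ** (Q ** ?E ** transpose P)
        = P ** (?D ** (transpose Q ** Q) ** ?E) ** transpose P"
    by (simp add: matrix_mul_assoc)
  also have "\<dots> = P ** transpose P"
    using assms(2) DE by (simp add: orthogonal_matrix)
  finally show ?thesis using assms(1) by (simp add: orthogonal_matrix_def)
qed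

lemma MR_energy_eq:
  assumes "principal_stretches F l"
  shows "MR_energy \<mu>1 \<mu>2 F = MR_stretch_energy \<mu>1 \<mu>2 l"
proof -
  have unique: "MR_stretch_energy \<mu>1 \<mu>2 k = MR_stretch_energy \<mu>1 \<mu>2 l"
    if k: "principal_stretches F k" and l: "principal_stretches F l" for k l
  proof -
    obtain P Q where PQ: "orthogonal_matrix P" "orthogonal_matrix Q"
        "F = P ** diag_matrix k ** transpose Q" "\<forall>i. 0 < k $ i"
      using k unfolding principal_stretches_def by blast
    obtain R S where RS: "orthogonal_matrix R" "orthogonal_matrix S"
        "F = R ** diag_matrix l ** transpose S" "\<forall>i. 0 < l $ i"
      using l unfolding principal_stretches_def by blast
    let ?G = "Q ** diag_matrix (\<chi> i. 1 / k $ i) ** transpose P"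
    let ?H = "S ** diag_matrix (\<chi> i. 1 / l $ i) ** transpose R"
    have "F ** ?G = mat 1" "F ** ?H = mat 1"
      using svd_inverse[OF PQ(1,2,4)] svd_inverse[OF RS(1,2,4)]
      by (simp_all only: PQ(3)[symmetric] RS(3)[symmetric])
    then have "?G = ?G ** (F ** ?H)" "?G ** F = mat 1"
      by (simp, simp only: matrix_left_right_inverse)
    then have GH: "?G = ?H"
      by (simp only: matrix_mul_assoc matrix_mul_lid)
    have "(\<Sum>i\<in>UNIV. (k $ i)\<^sup>2) = (\<Sum>i\<in>UNIV. (l $ i)\<^sup>2)"
      using trace_gram_svd[OF PQ(1,2), of k] trace_gram_svd[OF RS(1,2), of l]
      by (simp add: PQ(3)[symmetric] RS(3)[symmetric])
    moreover have "(\<Sum>i\<in>UNIV. 1 / (k $ i)\<^sup>2) = (\<Sum>i\<in>UNIV. 1 / (l $ i)\<^sup>2)"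
      using trace_gram_svd[OF PQ(2,1), of "\<chi> i. 1 / k $ i"]
        trace_gram_svd[OF RS(2,1), of "\<chi> i. 1 / l $ i"] GH
      by (simp add: power_divide)
    ultimately show ?thesis by (simp add: MR_stretch_energy_def)
  qed
  show ?thesis
    unfolding MR_energy_def by (rule unique[OF someI[of "principal_stretches F", OF assms] assms])
qed

definition body :: "(real^3) set" where
  "body = {X. \<forall>i. 0 < X $ i \<and> X $ i < 1}"

text \<open>The pieces are closed in the body, so that differentiability on each piece is one-sided at the
  interfaces. This excludes maps of Cantor type, which are differentiable merely off a null set.\<close>

definition piecewise_differentiable :: "(real^3 \<Rightarrow> real^3) \<Rightarrow> (real^3) set \<Rightarrow> bool" where
  "piecewise_differentiable y V \<longleftrightarrow>
     (\<exists>\<P>. finite \<P> \<and> \<Union>\<P> = V \<and>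
       (\<forall>P\<in>\<P>. closedin (top_of_set V) P \<and> negligible (frontier P) \<and> y differentiable_on P))"

text \<open>The deformation gradient is the Jacobian matrix; at points where the deformation is not
  differentiable it is unspecified, hence the guards below and the completed measure in the energy.\<close>

definition admissible :: "(real^3 \<Rightarrow> real^3) \<Rightarrow> bool" where
  "admissible y \<longleftrightarrow>
     continuous_on body y \<and> piecewise_differentiable y body \<and>
     (\<forall>X\<in>body. y differentiable (at X) \<longrightarrow> det (jacobian y (at X)) = 1)"

definition gradients_within :: "real \<Rightarrow> (real^3 \<Rightarrow> real^3) \<Rightarrow> (real^3 \<Rightarrow> real^3) \<Rightarrow> bool" where
  "gradients_within \<epsilon> x y \<longleftrightarrow>
     (\<forall>X\<in>body. x differentiable (at X) \<longrightarrow> y differentiable (at X) \<longrightarrow>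
        norm (jacobian y (at X) - jacobian x (at X)) < \<epsilon>)"

definition total_energy :: "real \<Rightarrow> real \<Rightarrow> real \<Rightarrow> (real^3 \<Rightarrow> real^3) \<Rightarrow> real" where
  "total_energy \<mu>1 \<mu>2 \<tau> x =
     (LINT X:body|lebesgue. MR_energy \<mu>1 \<mu>2 (jacobian x (at X)) - \<tau> * trace (jacobian x (at X)))"

definition unstable :: "real \<Rightarrow> real \<Rightarrow> real \<Rightarrow> (real^3 \<Rightarrow> real^3) \<Rightarrow> bool" where
  "unstable \<mu>1 \<mu>2 \<tau> x \<longleftrightarrow>
     \<not> (\<exists>\<epsilon>>0. \<forall>y. admissible y \<and> gradients_within \<epsilon> x y \<longrightarrow>
            total_energy \<mu>1 \<mu>2 \<tau> x \<le> total_energy \<mu>1 \<mu>2 \<tau> y)"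

definition homogeneous_stretch :: "(real^3 \<Rightarrow> real^3) \<Rightarrow> real^3 \<Rightarrow> bool" where
  "homogeneous_stretch x l \<longleftrightarrow>
     (\<forall>i. 0 < l $ i) \<and> (\<Prod>i\<in>UNIV. l $ i) = 1 \<and>
     (\<forall>X\<in>body. (x has_derivative (\<lambda>h. diag_matrix l *v h)) (at X))"

text \<open>In the next two definitions \<open>p\<close> is the constant pressure, the multiplier of the
  incompressibility constraint.\<close>

definition equilibrium :: "real \<Rightarrow> real \<Rightarrow> real \<Rightarrow> real \<Rightarrow> real^3 \<Rightarrow> bool" where
  "equilibrium \<mu>1 \<mu>2 \<tau> p l \<longleftrightarrow>
     (\<forall>i. - p / l $ i + \<mu>1 * l $ i - \<mu>2 / (l $ i) ^ 3 = \<tau>)"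

definition cauchy_stress :: "real \<Rightarrow> real \<Rightarrow> real \<Rightarrow> real^3 \<Rightarrow> 3 \<Rightarrow> real" where
  "cauchy_stress \<mu>1 \<mu>2 p l i = - p + \<mu>1 * (l $ i)\<^sup>2 - \<mu>2 / (l $ i)\<^sup>2"

definition baker_ericksen :: "real \<Rightarrow> real \<Rightarrow> real \<Rightarrow> real^3 \<Rightarrow> bool" where
  "baker_ericksen \<mu>1 \<mu>2 p l \<longleftrightarrow>
     (\<forall>i j. l $ i \<noteq> l $ j \<longrightarrow>
        (cauchy_stress \<mu>1 \<mu>2 p l i - cauchy_stress \<mu>1 \<mu>2 p l j) * (l $ i - l $ j) > 0)"

end

theory Submission
  imports Defs
begin

text \<open>
  Homogeneous perturbations already destabilise the stretch. Since \<open>\<lambda> \<mapsto> \<mu>1 \<lambda>\<^sup>2 - \<mu>2 \<lambda>\<^sup>-\<^sup>2 - \<tau> \<lambda>\<close>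
  is strictly convex, it takes the value \<open>p\<close> at most twice, so a non-trivial equilibrium has
  stretches \<open>a, a, 1/a\<^sup>2\<close> with \<open>a \<noteq> 1\<close>, and the load is
  \<open>\<tau>(a) = (a + 1/a\<^sup>2) (\<mu>1 + \<mu>2 a\<^sup>2)\<close>. For \<open>a < 1\<close> the second variation is negative when the two
  equal stretches are split to \<open>ac, a/c\<close>. For \<open>a > 1\<close> the energy of \<open>(c, c, 1/c\<^sup>2)\<close> has the
  \<open>c\<close>-derivative \<open>2 (1 - c\<^sup>-\<^sup>3) (\<tau>(c) - \<tau>(a))\<close>, which is negative for \<open>c > a\<close> because \<open>\<tau>\<close>
  decreases strictly exactly when \<open>\<mu>2/\<mu>1 \<le> -1/5\<^bsup>5/3\<^esup>\<close>.
\<close>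

section \<open>Energy of homogeneous stretches, and homogeneous competitors\<close>

definition stretch_potential :: "real \<Rightarrow> real \<Rightarrow> real \<Rightarrow> real^3 \<Rightarrow> real" where
  "stretch_potential \<mu>1 \<mu>2 \<tau> l = MR_stretch_energy \<mu>1 \<mu>2 l - \<tau> * (\<Sum>i\<in>UNIV. l $ i)"

definition dead_load :: "real \<Rightarrow> real \<Rightarrow> real \<Rightarrow> real" where
  "dead_load \<mu>1 \<mu>2 a = (a + 1 / a\<^sup>2) * (\<mu>1 + \<mu>2 * a\<^sup>2)"

lemma body_eq_box: "body = box 0 (\<chi> i. 1)"
  by (auto simp: body_def mem_box_cart)

lemma measure_body: "measure lebesgue body > 0"
proof -
  have "(\<chi> i. 1 / 2) \<in> body"
    by (simp add: body_def)
  then have "body \<noteq> {}"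
    by blast
  then have "emeasure lebesgue body \<noteq> 0"
    using open_not_negligible[of body] by (simp add: body_eq_box negligible_iff_emeasure0 open_box)
  then show ?thesis
    using emeasure_lborel_box_finite[of 0 "(\<chi> i. 1) :: real^3"]
    by (simp add: body_eq_box measure_def enn2real_positive_iff zero_less_iff_neq_zero)
qed

lemma MR_energy_diag_matrix:
  assumes "\<forall>i. 0 < l $ i"
  shows "MR_energy \<mu>1 \<mu>2 (diag_matrix l) = MR_stretch_energy \<mu>1 \<mu>2 l"
proof (rule MR_energy_eq)
  show "principal_stretches (diag_matrix l) l"
    unfolding principal_stretches_def using assms
    by (intro conjI exI[of _ "mat 1"]) (simp_all add: orthogonal_matrix_id)
qed

lemma trace_diag_matrix: "trace (diag_matrix l) = (\<Sum>i\<in>UNIV. l $ i)"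
  by (simp add: trace_def diag_matrix_def)

lemma det_diag_matrix: "det (diag_matrix l) = (\<Prod>i\<in>UNIV. l $ i)"
  by (subst det_diagonal) (simp_all add: diag_matrix_def)

lemma jacobian_homogeneous_stretch:
  assumes "homogeneous_stretch x l" "X \<in> body"
  shows "jacobian x (at X) = diag_matrix l"
proof -
  have "(x has_derivative (\<lambda>h. diag_matrix l *v h)) (at X)"
    using assms by (simp add: homogeneous_stretch_def)
  then show ?thesis
    unfolding jacobian_def by (metis frechet_derivative_at matrix_of_matrix_vector_mul)
qed

lemma total_energy_homogeneous_stretch:
  assumes "homogeneous_stretch x l"
  shows "total_energy \<mu>1 \<mu>2 \<tau> x = measure lebesgue body * stretch_potential \<mu>1 \<mu>2 \<tau> l"
proof -
  have "total_energy \<mu>1 \<mu>2 \<tau> x = (LINT X:body|lebesgue. stretch_potential \<mu>1 \<mu>2 \<tau> l)"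
    unfolding total_energy_def
  proof (rule set_lebesgue_integral_cong)
    show "body \<in> sets lebesgue"
      by (simp add: body_eq_box)
    show "\<forall>X. X \<in> body \<longrightarrow> MR_energy \<mu>1 \<mu>2 (jacobian x (at X)) - \<tau> * trace (jacobian x (at X))
        = stretch_potential \<mu>1 \<mu>2 \<tau> l"
      using assms
      by (auto simp: jacobian_homogeneous_stretch[OF assms] MR_energy_diag_matrix
          trace_diag_matrix stretch_potential_def homogeneous_stretch_def)
  qed
  also have "\<dots> = measure lebesgue body * stretch_potential \<mu>1 \<mu>2 \<tau> l"
    by (simp add: set_lebesgue_integral_def body_eq_box)
  finally show ?thesis .
qed

lemma homogeneous_stretch_diag_matrix:
  assumes "\<forall>i. 0 < l $ i" "(\<Prod>i\<in>UNIV. l $ i) = 1"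
  shows "homogeneous_stretch (\<lambda>X. diag_matrix l *v X) l"
  unfolding homogeneous_stretch_def using assms
  by (auto intro!: bounded_linear_imp_has_derivative matrix_vector_mul_bounded_linear)

lemma admissible_homogeneous_stretch:
  assumes "homogeneous_stretch y l"
  shows "admissible y"
proof -
  have "y differentiable (at X)" if "X \<in> body" for X
    using assms that unfolding homogeneous_stretch_def differentiable_def by blast
  then have diff: "y differentiable_on body"
    by (simp add: differentiable_at_imp_differentiable_on)
  have "negligible (frontier body)"
    by (simp add: body_eq_box negligible_convex_frontier)
  then have "piecewise_differentiable y body"
    unfolding piecewise_differentiable_def using diff by (intro exI[of _ "{body}"]) simp
  then show ?thesis
    unfolding admissible_def
    using assms diff
    by (auto simp: jacobian_homogeneous_stretch[OF assms] det_diag_matrix homogeneous_stretch_def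
        differentiable_imp_continuous_on)
qed

text \<open>Linear maps with diagonal gradient serve as competitors: their gradients are constant,
  so closeness of gradients reduces to convergence of the stretches, and energy is volume times
  potential. The filter \<open>F\<close> lets each case choose its own curve \<open>k\<close> of
  stretches and a one-sided limit along it.\<close>

lemma unstable_if_lower_potential_nearby:
  assumes x: "homogeneous_stretch x l"
    and F: "F \<noteq> bot" and lim: "\<And>i. ((\<lambda>c. k c $ i) \<longlongrightarrow> l $ i) F"
    and ev: "eventually (\<lambda>c. (\<forall>i. 0 < k c $ i) \<and> (\<Prod>i\<in>UNIV. k c $ i) = 1
               \<and> stretch_potential \<mu>1 \<mu>2 \<tau> (k c) < stretch_potential \<mu>1 \<mu>2 \<tau> l) F"
  shows "unstable \<mu>1 \<mu>2 \<tau> x"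
  unfolding unstable_def
proof clarify
  fix \<epsilon> :: real
  assume "\<epsilon> > 0" and min: "\<forall>y. admissible y \<and> gradients_within \<epsilon> x y
      \<longrightarrow> total_energy \<mu>1 \<mu>2 \<tau> x \<le> total_energy \<mu>1 \<mu>2 \<tau> y"
  have "((\<lambda>c. diag_matrix (k c)) \<longlongrightarrow> diag_matrix l) F"
    unfolding diag_matrix_def by (intro vec_tendstoI) (simp add: lim)
  then have "eventually (\<lambda>c. norm (diag_matrix (k c) - diag_matrix l) < \<epsilon>) F"
    using \<open>\<epsilon> > 0\<close> by (auto simp: tendsto_iff dist_norm)
  from eventually_happens'[OF F eventually_conj[OF this ev]] obtain c where
    near: "norm (diag_matrix (k c) - diag_matrix l) < \<epsilon>"
    and pos: "\<forall>i. 0 < k c $ i" and vol: "(\<Prod>i\<in>UNIV. k c $ i) = 1"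
    and less: "stretch_potential \<mu>1 \<mu>2 \<tau> (k c) < stretch_potential \<mu>1 \<mu>2 \<tau> l"
    by blast
  define y where "y = (\<lambda>X. diag_matrix (k c) *v X)"
  have y: "homogeneous_stretch y (k c)"
    unfolding y_def by (rule homogeneous_stretch_diag_matrix[OF pos vol])
  have "gradients_within \<epsilon> x y"
    using near
    by (simp add: gradients_within_def jacobian_homogeneous_stretch[OF x]
        jacobian_homogeneous_stretch[OF y])
  with min admissible_homogeneous_stretch[OF y]
  have "total_energy \<mu>1 \<mu>2 \<tau> x \<le> total_energy \<mu>1 \<mu>2 \<tau> y"
    by blast
  \<comment> \<open>The positive volume of the body makes the strict inequality of potentials one of
    energies.\<close>
  with less show False
    using measure_body
    by (simp add: total_energy_homogeneous_stretch[OF x] total_energy_homogeneous_stretch[OF y])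
qed

section \<open>Shape and load of the non-trivial equilibria\<close>

lemma sum_over_3:
  fixes f :: "3 \<Rightarrow> real"
  assumes "UNIV = {i, j, k}" "i \<noteq> j" "i \<noteq> k" "j \<noteq> k"
  shows "(\<Sum>n\<in>UNIV. f n) = f i + f j + f k"
  unfolding assms(1) using assms(2-) by (simp add: add.assoc mult.assoc)

lemma prod_over_3:
  fixes f :: "3 \<Rightarrow> real"
  assumes "UNIV = {i, j, k}" "i \<noteq> j" "i \<noteq> k" "j \<noteq> k"
  shows "(\<Prod>n\<in>UNIV. f n) = f i * f j * f k"
  unfolding assms(1) using assms(2-) by (simp add: add.assoc mult.assoc)

text \<open>Multiplied by the stretch, the equilibrium equation contains \<open>p\<close> only as an
  additive constant. Subtracting two of these equations eliminates it and shows the load as a chord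
  slope of \<open>\<mu>1 * w\<^sup>2 - \<mu>2 / w\<^sup>2\<close>.\<close>

lemma equilibrium_load:
  assumes "equilibrium \<mu>1 \<mu>2 \<tau> p l" "\<forall>i. 0 < l $ i" "l $ i \<noteq> l $ j"
  shows "\<tau> = (l $ i + l $ j) * (\<mu>1 + \<mu>2 / (l $ i * l $ j)\<^sup>2)"
proof -
  have *: "l $ n \<noteq> 0" for n
    using assms(2) by (metis less_irrefl)
  have p: "\<tau> * l $ n + p = \<mu>1 * (l $ n)\<^sup>2 - \<mu>2 / (l $ n)\<^sup>2" for n
  proof -
    have "\<tau> = - p / l $ n + \<mu>1 * l $ n - \<mu>2 / (l $ n) ^ 3"
      using assms(1) by (simp add: equilibrium_def)
    then show ?thesis
      using *[of n] by (simp add: divide_simps) algebra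
  qed
  have "\<tau> * (l $ i - l $ j)
      = \<mu>1 * (l $ i)\<^sup>2 - \<mu>2 / (l $ i)\<^sup>2 - (\<mu>1 * (l $ j)\<^sup>2 - \<mu>2 / (l $ j)\<^sup>2)"
    using p[of i] p[of j] by (simp add: algebra_simps)
  also have "\<dots> = (l $ i + l $ j) * (\<mu>1 + \<mu>2 / (l $ i * l $ j)\<^sup>2) * (l $ i - l $ j)"
    using *[of i] *[of j] by (simp add: divide_simps power2_eq_square) algebra
  finally show ?thesis
    using assms(3) by simp
qed

text \<open>By \<open>equilibrium_load\<close> both chords starting at \<open>l $ i\<close> have
  slope \<open>\<tau>\<close>. Chord slopes of a strictly convex function from a fixed point
  increase strictly with the other endpoint, so the endpoints coincide.\<close>

lemma equilibrium_not_three_stretches: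
  assumes "equilibrium \<mu>1 \<mu>2 \<tau> p l" "\<forall>i. 0 < l $ i" "\<mu>1 > 0" "\<mu>2 < 0"
    and "l $ i \<noteq> l $ j" "l $ i \<noteq> l $ k"
  shows "l $ j = l $ k"
proof -
  define r s t where "r = l $ i" and "s = l $ j" and "t = l $ k"
  have pos: "r > 0" "s > 0" "t > 0"
    using assms(2) by (simp_all add: r_def s_def t_def)
  have less: "(r + u) * (\<mu>1 + \<mu>2 / (r * u)\<^sup>2) < (r + v) * (\<mu>1 + \<mu>2 / (r * v)\<^sup>2)"
    if "0 < u" "u < v" for u v
  proof -
    \<comment> \<open>The expansion separates a part increasing in \<open>w\<close> from one that
      decreases in \<open>w\<close> and is multiplied by the negative \<open>\<mu>2\<close>.\<close>
    have eq: "(r + w) * (\<mu>1 + \<mu>2 / (r * w)\<^sup>2) = \<mu>1 * (r + w) + \<mu>2 * (1 / r * (1 / w)\<^sup>2 + (1 / r)\<^sup>2 * (1 / w))"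
      if "w > 0" for w
      using that pos by (simp add: field_simps power2_eq_square)
    have inv: "1 / v < 1 / u" "0 < 1 / v"
      using that by (simp_all add: field_simps)
    then have "(1 / v)\<^sup>2 < (1 / u)\<^sup>2"
      by (intro power_strict_mono) auto
    with inv have "1 / r * (1 / v)\<^sup>2 + (1 / r)\<^sup>2 * (1 / v) < 1 / r * (1 / u)\<^sup>2 + (1 / r)\<^sup>2 * (1 / u)"
      using pos by (intro add_strict_mono mult_strict_left_mono) auto
    then have "\<mu>2 * (1 / r * (1 / u)\<^sup>2 + (1 / r)\<^sup>2 * (1 / u)) < \<mu>2 * (1 / r * (1 / v)\<^sup>2 + (1 / r)\<^sup>2 * (1 / v))"
      using \<open>\<mu>2 < 0\<close> by (rule mult_strict_left_mono_neg)
    moreover have "\<mu>1 * (r + u) < \<mu>1 * (r + v)"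
      using \<open>\<mu>1 > 0\<close> that by simp
    ultimately show ?thesis
      using that by (simp only: eq)
  qed
  have "(r + s) * (\<mu>1 + \<mu>2 / (r * s)\<^sup>2) = (r + t) * (\<mu>1 + \<mu>2 / (r * t)\<^sup>2)"
    using equilibrium_load[OF assms(1,2,5)] equilibrium_load[OF assms(1,2,6)]
    by (simp add: r_def s_def t_def)
  with less[of s t] less[of t s] pos have "s = t"
    by (metis less_irrefl linorder_neqE_linordered_idom)
  then show ?thesis
    by (simp add: s_def t_def)
qed

text \<open>Chords are estimated instead of the derivative: at the critical ratio the derivative
  vanishes at the cube root of 5, whereas every chord slope stays strictly negative.\<close>

lemma dead_load_strict_antimono:
  assumes "\<mu>1 > 0" and ratio: "\<mu>2 / \<mu>1 \<le> - (1 / 5 powr (5 / 3))"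
    and "0 < a" "a < c"
  shows "dead_load \<mu>1 \<mu>2 c < dead_load \<mu>1 \<mu>2 a"
proof -
  \<comment> \<open>With this \<open>q\<close> the bound on the ratio reads
    \<open>\<mu>1 \<le> - \<mu>2 * q ^ 5\<close>, and \<open>q ^ 3 = 5\<close> supplies the
    coefficient of the cubic term below.\<close>
  define q :: real where "q = 5 powr (1 / 3)"
  have q: "q > 0" "q ^ 3 = 5" "q ^ 5 = 5 powr (5 / 3)"
    by (simp_all add: q_def powr_power)
  have \<mu>2: "\<mu>1 \<le> - \<mu>2 * q ^ 5"
    using ratio \<open>\<mu>1 > 0\<close> by (simp add: q field_simps)
  then have "- \<mu>2 * q ^ 5 > 0"
    using \<open>\<mu>1 > 0\<close> by linarith
  then have neg: "\<mu>2 < 0"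
    using q(1) by (simp add: mult_less_0_iff)
  \<comment> \<open>AM-GM for \<open>a + c\<close> and \<open>a\<^sup>2 + ac + c\<^sup>2\<close> reduces the chord slope of the load to the quintic
    inequality in the geometric mean \<open>r\<close>, whose critical point is \<open>r = q\<close>.\<close>
  define r where "r = sqrt (a * c)"
  define t where "t = r / q"
  have r: "r > 0" "r\<^sup>2 = a * c" and t: "t > 0" "r = q * t"
    using assms q by (simp_all add: r_def t_def)
  \<comment> \<open>The double root at \<open>t = 1\<close>, that is \<open>r = q\<close>, makes the
    threshold just sufficient.\<close>
  have "3 * t ^ 5 - 5 * t ^ 3 + 2 = (t - 1)\<^sup>2 * (3 * t ^ 3 + 6 * t\<^sup>2 + 4 * t + 2)"
    by algebra
  also have "\<dots> \<ge> 0"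
    using t(1) by simp
  finally have "\<mu>1 * (5 * t ^ 3) \<le> \<mu>1 * 2 + 3 * t ^ 5 * \<mu>1"
    using mult_left_mono[of "5 * t ^ 3" "2 + 3 * t ^ 5" \<mu>1] \<open>\<mu>1 > 0\<close> by (simp add: algebra_simps)
  also have "\<dots> \<le> \<mu>1 * 2 + 3 * t ^ 5 * (- \<mu>2 * q ^ 5)"
    using \<mu>2 t(1) by (intro add_left_mono mult_left_mono) simp_all
  finally have amgm: "\<mu>1 * r ^ 3 \<le> 2 * \<mu>1 - 3 * \<mu>2 * r ^ 5"
    by (simp add: t(2) power_mult_distrib q(2) algebra_simps)
  have "(2 * r)\<^sup>2 \<le> (a + c)\<^sup>2"
    using zero_le_power2[of "a - c"] r(2) by (simp add: power2_eq_square algebra_simps)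
  then have sum: "2 * r \<le> a + c"
    using assms(3,4) by (intro power2_le_imp_le[of "2 * r"]) auto
  \<comment> \<open>Strictness of the whole estimate comes from here, where \<open>a\<close> and
    \<open>c\<close> differ.\<close>
  have sq: "3 * r\<^sup>2 < a\<^sup>2 + a * c + c\<^sup>2"
  proof -
    have "0 < (c - a)\<^sup>2" using assms(4) by simp
    then show ?thesis unfolding r(2) by (simp add: power2_eq_square algebra_simps)
  qed
  have "\<mu>1 * r ^ 4 \<le> \<mu>1 * (2 * r) + (- \<mu>2) * r ^ 4 * (3 * r\<^sup>2)"
    using mult_left_mono[OF amgm, of r] r(1) by (simp add: algebra_simps power_def numeral_eq_Suc)
  also have "\<dots> < \<mu>1 * (a + c) + (- \<mu>2) * r ^ 4 * (a\<^sup>2 + a * c + c\<^sup>2)"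
    using sum sq neg r(1) \<open>\<mu>1 > 0\<close>
    by (intro add_le_less_mono mult_left_mono mult_strict_left_mono) (auto intro: mult_neg_pos)
  finally have "0 < \<mu>1 * (a + c) - \<mu>2 * r ^ 4 * (a\<^sup>2 + a * c + c\<^sup>2) - \<mu>1 * r ^ 4"
    by simp
  moreover have "r ^ 4 = (a * c)\<^sup>2"
    by (simp add: r(2)[symmetric])
  ultimately have "0 < (c - a) * (\<mu>1 * (a + c) - \<mu>2 * (a * c)\<^sup>2 * (a\<^sup>2 + a * c + c\<^sup>2) - \<mu>1 * (a * c)\<^sup>2) / (a * c)\<^sup>2"
    using assms(3,4) by simp
  also have "\<dots> = dead_load \<mu>1 \<mu>2 a - dead_load \<mu>1 \<mu>2 c"
    using assms(3,4) by (simp add: dead_load_def divide_simps) algebra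
  finally show ?thesis by simp
qed

section \<open>Destabilising perturbations in the two cases\<close>

lemma unstable_if_equal_pair_gt_1:
  assumes x: "homogeneous_stretch x l"
    and \<mu>: "\<mu>1 > 0" "\<mu>2 / \<mu>1 \<le> - (1 / 5 powr (5 / 3))"
    and U: "UNIV = {i, j, k}" "i \<noteq> j" "i \<noteq> k" "j \<noteq> k"
    and l: "l $ i = a" "l $ j = a" "l $ k = 1 / a\<^sup>2" and a: "a > 1"
    and \<tau>: "\<tau> = dead_load \<mu>1 \<mu>2 a"
  shows "unstable \<mu>1 \<mu>2 \<tau> x"
proof (rule unstable_if_lower_potential_nearby[OF x])
  define m where "m = (\<lambda>c. (\<chi> n. if n = k then 1 / c\<^sup>2 else c) :: real^3)"
  define e where "e = (\<lambda>c. stretch_potential \<mu>1 \<mu>2 \<tau> (m c))"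
  have U': "n = i \<or> n = j \<or> n = k" for n
    using U(1) by blast
  have ml: "m a = l"
    using U' l by (simp add: m_def vec_eq_iff) metis
  show "at_right a \<noteq> bot"
    by simp
  show "((\<lambda>c. m c $ n) \<longlongrightarrow> l $ n) (at_right a)" for n
    unfolding ml[symmetric] m_def using a by (auto intro!: tendsto_eq_intros)
  have e: "e c = \<mu>1 / 2 * (2 * c\<^sup>2 + 1 / c ^ 4 - 3) + \<mu>2 / 2 * (2 / c\<^sup>2 + c ^ 4 - 3) - \<tau> * (2 * c + 1 / c\<^sup>2)" for c
    using U(2-) by (simp add: e_def stretch_potential_def MR_stretch_energy_def sum_over_3[OF U] m_def
        power_divide)
  have deriv: "(e has_real_derivative 2 * (1 - 1 / c ^ 3) * (dead_load \<mu>1 \<mu>2 c - \<tau>)) (at c)"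
    if "c > 1" for c
    unfolding e[abs_def] dead_load_def using that
    by (auto intro!: derivative_eq_intros) (simp add: divide_simps, algebra)
  have less: "e c < e a" if "c > a" for c
  proof (rule DERIV_neg_imp_decreasing_open[OF that])
    fix d assume d: "a < d" "d < c"
    have "dead_load \<mu>1 \<mu>2 d < \<tau>"
      unfolding \<tau> using dead_load_strict_antimono[OF \<mu>, of a d] a d by simp
    \<comment> \<open>Beyond \<open>a > 1\<close> the factor \<open>1 - 1 / d ^ 3\<close> is
      positive, so the sign is that of the falling load.\<close>
    then have "2 * (1 - 1 / d ^ 3) * (dead_load \<mu>1 \<mu>2 d - \<tau>) < 0"
      using a d by (intro mult_pos_neg) (simp_all add: divide_simps one_less_power)
    then show "\<exists>y. (e has_real_derivative y) (at d) \<and> y < 0"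
      using deriv[of d] a d by auto
  next
    show "continuous_on {a..c} e"
      using a by (intro DERIV_continuous_on[OF DERIV_subset[OF deriv]]) auto
  qed
  show "\<forall>\<^sub>F c in at_right a. (\<forall>n. 0 < m c $ n) \<and> (\<Prod>n\<in>UNIV. m c $ n) = 1 \<and>
      stretch_potential \<mu>1 \<mu>2 \<tau> (m c) < stretch_potential \<mu>1 \<mu>2 \<tau> l"
    using eventually_at_right_less[of a]
  proof eventually_elim
    case (elim c)
    then show ?case
      using less[OF elim] a U(2-)
      by (simp add: prod_over_3[OF U] e_def ml) (auto simp: m_def power2_eq_square)
  qed
qed

text \<open>Changing both equal stretches together would not help here: for \<open>c < 1\<close> the
  factor \<open>1 - 1 / c ^ 3\<close> is negative, so a strictly decreasing load makes
  \<open>a\<close> a local minimum along that family. The pair is split instead, with its product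
  and the third stretch kept fixed.\<close>

lemma unstable_if_equal_pair_lt_1:
  assumes x: "homogeneous_stretch x l"
    and \<mu>: "\<mu>1 > 0" "\<mu>2 < 0"
    and U: "UNIV = {i, j, k}" "i \<noteq> j" "i \<noteq> k" "j \<noteq> k"
    and l: "l $ i = a" "l $ j = a" "l $ k = 1 / a\<^sup>2" and a: "0 < a" "a < 1"
    and \<tau>: "\<tau> = dead_load \<mu>1 \<mu>2 a"
  shows "unstable \<mu>1 \<mu>2 \<tau> x"
proof (rule unstable_if_lower_potential_nearby[OF x])
  define m where "m = (\<lambda>c. (\<chi> n. if n = k then 1 / a\<^sup>2 else if n = i then a * c else a / c) :: real^3)"
  \<comment> \<open>\<open>v\<close> is the cofactor of \<open>(c - 1)\<^sup>2 / c\<close> in the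
    exact energy difference; \<open>v 1\<close> is half the second derivative of the energy at
    \<open>c = 1\<close>.\<close>
  define v where "v = (\<lambda>c. (\<mu>1 * a\<^sup>2 + \<mu>2 / a\<^sup>2) / 2 * (c + 1 / c + 2) - \<tau> * a)"
  have U': "n = i \<or> n = j \<or> n = k" for n
    using U(1) by blast
  have ml: "m 1 = l"
    using U' l U(2-) by (simp add: m_def vec_eq_iff) metis
  show "at_right (1::real) \<noteq> bot"
    by simp
  show "((\<lambda>c. m c $ n) \<longlongrightarrow> l $ n) (at_right 1)" for n
    unfolding ml[symmetric] m_def by (auto intro!: tendsto_eq_intros)
  have diff: "stretch_potential \<mu>1 \<mu>2 \<tau> (m c) - stretch_potential \<mu>1 \<mu>2 \<tau> (m 1) = (c - 1)\<^sup>2 / c * v c"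
    if "c > 0" for c
    using U(2-) that a
    by (simp add: stretch_potential_def MR_stretch_energy_def sum_over_3[OF U] m_def v_def divide_simps)
       (simp add: algebra_simps power_numeral_reduce)
  \<comment> \<open>Inserting the load isolates \<open>a ^ 3 - 1\<close>, whose sign encodes
    \<open>a < 1\<close>; the other factor is positive because \<open>\<mu>2 < 0\<close>.\<close>
  have "v 1 = (a ^ 3 - 1) / a\<^sup>2 * (\<mu>1 * a - \<mu>2 * (a ^ 3 + 2))"
    using a by (simp add: v_def \<tau> dead_load_def divide_simps) algebra
  also have "\<dots> < 0"
  proof (rule mult_neg_pos)
    show "(a ^ 3 - 1) / a\<^sup>2 < 0"
      using a by (simp add: divide_neg_pos power_less_one_iff)
    have "\<mu>2 * (a ^ 3 + 2) < 0"
      using \<mu> a by (intro mult_neg_pos) (simp_all add: add_pos_pos)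
    then show "0 < \<mu>1 * a - \<mu>2 * (a ^ 3 + 2)"
      using mult_pos_pos[OF \<mu>(1) a(1)] by linarith
  qed
  finally have "v 1 < 0" .
  moreover have "(v \<longlongrightarrow> v 1) (at_right 1)"
    unfolding v_def by (auto intro!: tendsto_eq_intros)
  ultimately have "\<forall>\<^sub>F c in at_right 1. v c < 0"
    by (simp add: order_tendstoD)
  then show "\<forall>\<^sub>F c in at_right 1. (\<forall>n. 0 < m c $ n) \<and> (\<Prod>n\<in>UNIV. m c $ n) = 1 \<and>
      stretch_potential \<mu>1 \<mu>2 \<tau> (m c) < stretch_potential \<mu>1 \<mu>2 \<tau> l"
    using eventually_at_right_less[of 1]
  proof eventually_elim
    case (elim c)
    then have "(c - 1)\<^sup>2 / c * v c < 0"
      by (intro mult_pos_neg) simp_all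
    with diff[of c] elim have "stretch_potential \<mu>1 \<mu>2 \<tau> (m c) < stretch_potential \<mu>1 \<mu>2 \<tau> l"
      by (simp add: ml)
    moreover have "\<forall>n. 0 < m c $ n"
      using elim a by (auto simp: m_def)
    moreover have "(\<Prod>n\<in>UNIV. m c $ n) = 1"
      using elim a U(2-) by (simp add: prod_over_3[OF U] m_def power2_eq_square)
    ultimately show ?case by blast
  qed
qed

theorem mainTheorem2:
  fixes \<mu>1 \<mu>2 \<tau> p :: real and l :: "real^3" and x :: "real^3 \<Rightarrow> real^3"
  assumes "\<mu>1 > 0" and "- \<mu>1 < \<mu>2" and "\<mu>2 < 0"
    and "\<mu>2 / \<mu>1 \<le> - (1 / 5 powr (5 / 3))"
    and "homogeneous_stretch x l"
    and "l \<noteq> (\<chi> i. 1)"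
    and "equilibrium \<mu>1 \<mu>2 \<tau> p l"
    and "baker_ericksen \<mu>1 \<mu>2 p l"
  shows "unstable \<mu>1 \<mu>2 \<tau> x"
proof -
  have pos: "\<forall>i. 0 < l $ i" and vol: "(\<Prod>i\<in>UNIV. l $ i) = 1"
    using assms(5) by (simp_all add: homogeneous_stretch_def)
  have pair: "l $ j = l $ k" if "l $ i \<noteq> l $ j" "l $ i \<noteq> l $ k" for i j k
    using equilibrium_not_three_stretches[OF assms(7) pos assms(1,3) that] .
  have "\<exists>i j k. UNIV = {i, j, k} \<and> i \<noteq> j \<and> i \<noteq> k \<and> j \<noteq> k \<and> l $ i = l $ j"
  proof -
    have "UNIV = {1, 2, 3 :: 3}" "UNIV = {2, 3, 1 :: 3}" "UNIV = {1, 3, 2 :: 3}"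
      using UNIV_3 by auto
    moreover have "(1::3) \<noteq> 2" "(1::3) \<noteq> 3" "(2::3) \<noteq> 3"
      by simp_all
    ultimately show ?thesis
      \<comment> \<open>If the first stretch differs from both others, those two coincide; each
        possible equal pair has its own listing of the indices with the remaining index
        last.\<close>
      using pair[of 1 2 3] by metis
  qed
  then obtain i j k where U: "UNIV = {i, j, k}" "i \<noteq> j" "i \<noteq> k" "j \<noteq> k" and ij: "l $ i = l $ j"
    by blast
  define a where "a = l $ i"
  have a: "a > 0" and li: "l $ i = a" and lj: "l $ j = a"
    using pos ij by (simp_all add: a_def)
  have lk: "l $ k = 1 / a\<^sup>2"
    using vol a by (simp add: prod_over_3[OF U] li lj field_simps power2_eq_square)
  have "a \<noteq> 1"
  proof
    assume "a = 1"
    then have "l $ n = 1" for n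
      using U(1) li lj lk by (metis UNIV_I insertE singletonD div_by_1 power_one)
    then show False
      using assms(6) by (simp add: vec_eq_iff)
  qed
  \<comment> \<open>The stretches \<open>a\<close> and \<open>1 / a\<^sup>2\<close> agree only if
    \<open>a ^ 3 = 1\<close>; their distinctness is what \<open>equilibrium_load\<close>
    requires.\<close>
  then have "a ^ 3 \<noteq> 1"
    using a power_inject_base[of a 2 1] by (auto simp: numeral_3_eq_3 numeral_2_eq_2)
  then have "l $ i \<noteq> l $ k"
    using a by (simp add: li lk field_simps power2_eq_square power3_eq_cube)
  from equilibrium_load[OF assms(7) pos this]
  have "\<tau> = dead_load \<mu>1 \<mu>2 a"
    using a by (simp add: li lk dead_load_def power_divide power2_eq_square)
  then show ?thesis
    using unstable_if_equal_pair_gt_1[OF assms(5,1,4) U li lj lk]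
      unstable_if_equal_pair_lt_1[OF assms(5,1,3) U li lj lk a] \<open>a \<noteq> 1\<close>
    by (cases "a < 1") auto
qed

end
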